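(* Let $K,N,n,m,p\ge 1$ be integers, let $F_1,\ldots,F_K\in\mathbb{R}^{n\times n}$, $H_1,\ldots,H_K\in\mathbb{R}^{m\times n}$, $G_1,\ldots,G_K\in\mathbb{R}^{n\times p}$, let $Q,P_0\in\mathbb{R}^{n\times n}$ and $R\in\mathbb{R}^{m\times m}$ be (symmetric) positive definite, let $\gamma_N>0$, and let $\hat x_0\in\mathbb{R}^n$. Let $\mathbf{y}^{N-1}=(y_t)_{t=0}^{N-1}$ with $y_t\in\mathbb{R}^m$ and $\mathbf{u}^{N-1}=(u_t)_{t=0}^{N-1}$ with $u_t\in\mathbb{R}^p$ be given, and let $P_{t,i}$, $\breve x_{t,i}$, $c_{t,i}$ and the cost $J_N(\mathbf{y}^{N-1},\mathbf{u}^{N-1},\hat y_N)$ be as defined in the context. Assume that $H_iP_{N,i}H_i^\top\prec\gamma_N^2I$ for every $i=1,\ldots,K$. Consider the convex program in the variables $\hat y_N\in\mathbb{R}^m$, $s\in\mathbb{R}$: $$\begin{aligned}\underset{\hat y_N,\,s}{\text{minimize}}\quad & s\\ \text{subject to}\quad & |\hat y_N-H_i\breve x_{N,i}|^2_{(I-\gamma_N^{-2}H_iP_{N,i}H_i^\top)^{-1}}-\gamma_N^2c_{N,i}\le s\qquad\text{for all } i=1,\ldots,K.\end{aligned}$$ Then the minimizing argument $\hat y_N^\star$ of this program satisfies $$\inf_{\hat y_N\in\mathbb{R}^m}J_N(\mathbf{y}^{N-1},\mathbf{u}^{N-1},\hat y_N)=J_N(\mathbf{y}^{N-1},\mathbf{u}^{N-1},\hat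 y_N^\star).$$
   Context: For $x\in\mathbb{R}^n$ and a symmetric matrix $A\in\mathbb{R}^{n\times n}$, $|x|_A^2:=x^\top Ax$, and $|x|^2:=x^\top x$. For symmetric matrices, $A\prec B$ means that $B-A$ is positive definite. For $i=1,\ldots,K$ define recursively $$P_{0,i}=P_0,\qquad P_{t+1,i}=Q+F_i\bigl(P_{t,i}-P_{t,i}H_i^\top(R+H_iP_{t,i}H_i^\top)^{-1}H_iP_{t,i}\bigr)F_i^\top,$$ $$\breve x_{0,i}=\hat x_0,\qquad \breve x_{t+1,i}=F_i\breve x_{t,i}+K_{t,i}(y_t-H_i\breve x_{t,i})+G_iu_t,\qquad K_{t,i}=F_iP_{t,i}H_i^\top(R+H_iP_{t,i}H_i^\top)^{-1},$$ $$c_{0,i}=0,\qquad c_{t+1,i}=|H_i\breve x_{t,i}-y_t|^2_{(R+H_iP_{t,i}H_i^\top)^{-1}}+c_{t,i}.$$ The cost is $$J_N(\mathbf{y}^{N-1},\mathbf{u}^{N-1},\hat y_N)=\sup_{(x_0,\ldots,x_N)\in(\mathbb{R}^n)^{N+1},\ i\in\{1,\ldots,K\}}\Bigl\{|\hat y_N-H_ix_N|^2-\gamma_N^2|x_0-\hat x_0|^2_{P_0^{-1}}-\gamma_N^2\sum_{t=0}^{N-1}\bigl(|x_{t+1}-F_ix_t-G_iu_t|^2_{Q^{-1}}+|y_t-H_ix_t|^2_{R^{-1}}\bigr)\Bigr\}.$$ *)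

theory Defs
  imports "HOL-Analysis.Analysis"
begin

definition pos_def :: "real^'n^'n \<Rightarrow> bool" where
  "pos_def A \<longleftrightarrow> transpose A = A \<and> (\<forall>x. x \<noteq> 0 \<longrightarrow> x \<bullet> (A *v x) > 0)"

definition loewner_less :: "real^'n^'n \<Rightarrow> real^'n^'n \<Rightarrow> bool"  (infix "\<prec>\<^sub>L" 50) where
  "A \<prec>\<^sub>L B \<longleftrightarrow> pos_def (B - A)"

definition wnorm2 :: "real^'n^'n \<Rightarrow> real^'n \<Rightarrow> real" where
  "wnorm2 A x = x \<bullet> (A *v x)"

text \<open>The recursions below are for a single model; \<open>F\<close>, \<open>H\<close>, \<open>G\<close> stand for
  \<open>F\<^sub>i\<close>, \<open>H\<^sub>i\<close>, \<open>G\<^sub>i\<close>.\<close>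

definition innov_cov :: "real^'n^'m \<Rightarrow> real^'m^'m \<Rightarrow> real^'n^'n \<Rightarrow> real^'m^'m" where
  "innov_cov H R P = R + H ** P ** transpose H"

primrec Pmat :: "real^'n^'n \<Rightarrow> real^'n^'m \<Rightarrow> real^'n^'n \<Rightarrow> real^'m^'m \<Rightarrow> real^'n^'n
    \<Rightarrow> nat \<Rightarrow> real^'n^'n" where
  "Pmat F H Q R P0 0 = P0"
| "Pmat F H Q R P0 (Suc t) =
     (let P = Pmat F H Q R P0 t in
      Q + F ** (P - P ** transpose H ** matrix_inv (innov_cov H R P) ** H ** P) ** transpose F)"

definition gain :: "real^'n^'n \<Rightarrow> real^'n^'m \<Rightarrow> real^'n^'n \<Rightarrow> real^'m^'m \<Rightarrow> real^'n^'n
    \<Rightarrow> nat \<Rightarrow> real^'m^'n" where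
  "gain F H Q R P0 t =
     (let P = Pmat F H Q R P0 t in
      F ** P ** transpose H ** matrix_inv (innov_cov H R P))"

primrec xbreve :: "real^'n^'n \<Rightarrow> real^'n^'m \<Rightarrow> real^'p^'n \<Rightarrow> real^'n^'n \<Rightarrow> real^'m^'m
    \<Rightarrow> real^'n^'n \<Rightarrow> real^'n \<Rightarrow> (nat \<Rightarrow> real^'m) \<Rightarrow> (nat \<Rightarrow> real^'p) \<Rightarrow> nat \<Rightarrow> real^'n" where
  "xbreve F H G Q R P0 xhat0 y u 0 = xhat0"
| "xbreve F H G Q R P0 xhat0 y u (Suc t) =
     (let x = xbreve F H G Q R P0 xhat0 y u t in
      F *v x + gain F H Q R P0 t *v (y t - H *v x) + G *v u t)"

primrec cacc :: "real^'n^'n \<Rightarrow> real^'n^'m \<Rightarrow> real^'p^'n \<Rightarrow> real^'n^'n \<Rightarrow> real^'m^'m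
    \<Rightarrow> real^'n^'n \<Rightarrow> real^'n \<Rightarrow> (nat \<Rightarrow> real^'m) \<Rightarrow> (nat \<Rightarrow> real^'p) \<Rightarrow> nat \<Rightarrow> real" where
  "cacc F H G Q R P0 xhat0 y u 0 = 0"
| "cacc F H G Q R P0 xhat0 y u (Suc t) =
     wnorm2 (matrix_inv (innov_cov H R (Pmat F H Q R P0 t)))
       (H *v xbreve F H G Q R P0 xhat0 y u t - y t)
     + cacc F H G Q R P0 xhat0 y u t"

text \<open>The supremum is taken in the extended reals, so that it is meaningful whether or not the
  objective is bounded above. Trajectories \<open>(x\<^sub>0, \<dots>, x\<^sub>N)\<close> are extensional functions on
  \<open>{0..N}\<close>.\<close>

definition cost :: "nat \<Rightarrow> (nat \<Rightarrow> real^'n^'n) \<Rightarrow> (nat \<Rightarrow> real^'n^'m) \<Rightarrow> (nat \<Rightarrow> real^'p^'n)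
    \<Rightarrow> real^'n^'n \<Rightarrow> real^'m^'m \<Rightarrow> real^'n^'n \<Rightarrow> real^'n \<Rightarrow> real \<Rightarrow> nat
    \<Rightarrow> (nat \<Rightarrow> real^'m) \<Rightarrow> (nat \<Rightarrow> real^'p) \<Rightarrow> real^'m \<Rightarrow> ereal" where
  "cost K F H G Q R P0 xhat0 \<gamma> N y u yhat =
     (SUP (x, i) \<in> ({0..N} \<rightarrow>\<^sub>E (UNIV :: (real^'n) set)) \<times> {1..K}. ereal (
        (norm (yhat - H i *v x N))\<^sup>2
        - \<gamma>\<^sup>2 * wnorm2 (matrix_inv P0) (x 0 - xhat0)
        - \<gamma>\<^sup>2 * (\<Sum>t<N. wnorm2 (matrix_inv Q) (x (t + 1) - F i *v x t - G i *v u t)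
                       + wnorm2 (matrix_inv R) (y t - H i *v x t))))"

definition feasible :: "nat \<Rightarrow> (nat \<Rightarrow> real^'n^'n) \<Rightarrow> (nat \<Rightarrow> real^'n^'m) \<Rightarrow> (nat \<Rightarrow> real^'p^'n)
    \<Rightarrow> real^'n^'n \<Rightarrow> real^'m^'m \<Rightarrow> real^'n^'n \<Rightarrow> real^'n \<Rightarrow> real \<Rightarrow> nat
    \<Rightarrow> (nat \<Rightarrow> real^'m) \<Rightarrow> (nat \<Rightarrow> real^'p) \<Rightarrow> (real^'m) \<times> real \<Rightarrow> bool" where
  "feasible K F H G Q R P0 xhat0 \<gamma> N y u = (\<lambda>(yhat, s).
     \<forall>i\<in>{1..K}.
       wnorm2 (matrix_inv (mat 1 - (1 / \<gamma>\<^sup>2) *\<^sub>R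
                 (H i ** Pmat (F i) (H i) Q R P0 N ** transpose (H i))))
         (yhat - H i *v xbreve (F i) (H i) (G i) Q R P0 xhat0 y u N)
       - \<gamma>\<^sup>2 * cacc (F i) (H i) (G i) Q R P0 xhat0 y u N \<le> s)"

text \<open>Minimizing \<open>s\<close> over the feasible pairs \<open>(yhat, s)\<close>: the objective is \<open>snd\<close>.\<close>

definition program_minimizer :: "nat \<Rightarrow> (nat \<Rightarrow> real^'n^'n) \<Rightarrow> (nat \<Rightarrow> real^'n^'m) \<Rightarrow> (nat \<Rightarrow> real^'p^'n)
    \<Rightarrow> real^'n^'n \<Rightarrow> real^'m^'m \<Rightarrow> real^'n^'n \<Rightarrow> real^'n \<Rightarrow> real \<Rightarrow> nat
    \<Rightarrow> (nat \<Rightarrow> real^'m) \<Rightarrow> (nat \<Rightarrow> real^'p) \<Rightarrow> (real^'m) \<times> real \<Rightarrow> bool" where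
  "program_minimizer K F H G Q R P0 xhat0 \<gamma> N y u =
     is_arg_min snd (feasible K F H G Q R P0 xhat0 \<gamma> N y u)"

end

theory Submission
  imports Defs
begin

text \<open>The single identity behind the result is completion of the square. Write
  \<open>|v|\<^sup>2(A)\<close> for \<open>v\<^sup>T A v\<close> and let \<open>S = B + L A L\<^sup>T\<close>. Then
  \<open>|x - a|\<^sup>2(A\<^sup>-\<^sup>1) + |b - L x|\<^sup>2(B\<^sup>-\<^sup>1) = |b - L a|\<^sup>2(S\<^sup>-\<^sup>1) + |x - x\<^sub>*|\<^sup>2(C\<^sup>-\<^sup>1)\<close>, where
  \<open>x\<^sub>* = a + A L\<^sup>T S\<^sup>-\<^sup>1 (b - L a)\<close> and \<open>C = A - A L\<^sup>T S\<^sup>-\<^sup>1 L A\<close>.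
  With \<open>B = R\<close> and then \<open>B = Q\<close> this is the measurement and the time update of the Kalman filter,
  so by forward dynamic programming the least disturbance cost of arriving at \<open>x\<^sub>N\<close> is the
  distance of \<open>x\<^sub>N\<close> to the filter estimate, weighted by the inverse of \<open>P\<^sub>N\<close>, plus \<open>c\<^sub>N\<close>.
  With the negative definite \<open>B = -\<gamma>\<^sup>2 I\<close> it evaluates the remaining supremum over \<open>x\<^sub>N\<close>.
  Hence the cost is the maximum of the finitely many strictly convex, coercive quadratics in the
  constraints of the program.\<close>

section \<open>Weighted square norms and inverse matrices\<close>

lemma wnorm2_minus [simp]: "wnorm2 A (- x) = wnorm2 A x"
  by (simp add: wnorm2_def vec.neg)

lemma wnorm2_zero [simp]: "wnorm2 A 0 = 0"
  by (simp add: wnorm2_def)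

lemma wnorm2_minus_commute: "wnorm2 A (x - y) = wnorm2 A (y - x)"
  by (metis minus_diff_eq wnorm2_minus)

lemma inner_symmetric_matrix:
  fixes A :: "real^'n^'n"
  assumes "transpose A = A"
  shows "x \<bullet> (A *v y) = (A *v x) \<bullet> y"
  by (metis assms dot_lmul_matrix transpose_matrix_vector)

lemma inner_transpose_matrix:
  fixes L :: "real^'n^'m"
  shows "x \<bullet> (transpose L *v y) = (L *v x) \<bullet> y"
  by (metis dot_lmul_matrix inner_commute transpose_matrix_vector)

lemma matrix_inv_inverse:
  fixes A :: "real^'n^'n"
  assumes "invertible A"
  shows "A ** matrix_inv A = mat 1" and "matrix_inv A ** A = mat 1"
  using assms someI_ex[of "\<lambda>B. A ** B = mat 1 \<and> B ** A = mat 1"]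
  by (auto simp: invertible_def matrix_inv_def)

lemma matrix_inv_mult_vector:
  fixes A :: "real^'n^'n"
  assumes "invertible A"
  shows "A *v (matrix_inv A *v x) = x" and "matrix_inv A *v (A *v x) = x"
  using assms by (simp_all add: matrix_vector_mul_assoc matrix_inv_inverse)

text \<open>For square matrices a one-sided inverse is two-sided, so a single product identity
  identifies both inverses. Later such an identity is checked instead of manipulating
  \<open>matrix_inv\<close>, which is a choice term.\<close>

lemma matrix_inv_unique_left:
  fixes A B :: "real^'n^'n"
  assumes "A ** B = mat 1"
  shows "matrix_inv A = B" and "matrix_inv B = A" and "invertible A" and "invertible B"
proof -
  have BA: "B ** A = mat 1"
    using assms by (simp add: matrix_left_right_inverse)
  show iA: "invertible A" and iB: "invertible B"
    using assms BA by (auto simp: invertible_def)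
  have "matrix_inv A ** A ** B = matrix_inv A"
    using assms by (metis matrix_mul_assoc matrix_mul_rid)
  then show "matrix_inv A = B"
    using iA by (simp add: matrix_inv_inverse)
  have "matrix_inv B ** B ** A = matrix_inv B"
    using BA by (metis matrix_mul_assoc matrix_mul_rid)
  then show "matrix_inv B = A"
    using iB by (simp add: matrix_inv_inverse)
qed

lemma transpose_matrix_inv_symmetric:
  fixes A :: "real^'n^'n"
  assumes "transpose A = A" and "invertible A"
  shows "transpose (matrix_inv A) = matrix_inv A"
proof -
  have "A ** transpose (matrix_inv A) = mat 1"
    using assms by (metis matrix_transpose_mul matrix_inv_inverse(2) transpose_mat)
  then show ?thesis
    by (metis matrix_inv_unique_left(1))
qed

section \<open>Positive definite matrices\<close>

lemma pos_def_symmetric: "pos_def A \<Longrightarrow> transpose A = A"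
  by (simp add: pos_def_def)

lemma pos_def_wnorm2_pos: "pos_def A \<Longrightarrow> x \<noteq> 0 \<Longrightarrow> 0 < wnorm2 A x"
  by (simp add: pos_def_def wnorm2_def)

lemma pos_def_wnorm2_nonneg: "pos_def A \<Longrightarrow> 0 \<le> wnorm2 A x"
  by (cases "x = 0") (auto intro: less_imp_le pos_def_wnorm2_pos)

lemma pos_def_invertible:
  assumes "pos_def A"
  shows "invertible A"
proof -
  have "x = 0" if "A *v x = 0" for x
    using assms that by (metis inner_zero_right order_less_irrefl pos_def_def)
  then show ?thesis
    by (simp add: invertible_left_inverse matrix_left_invertible_ker)
qed

lemma pos_def_matrix_inv:
  assumes "pos_def A"
  shows "pos_def (matrix_inv A)"
  unfolding pos_def_def
proof (intro conjI allI impI)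
  note inv = pos_def_invertible[OF assms]
  show "transpose (matrix_inv A) = matrix_inv A"
    by (rule transpose_matrix_inv_symmetric[OF pos_def_symmetric[OF assms] inv])
  fix x :: "real^'a" assume "x \<noteq> 0"
  then have "matrix_inv A *v x \<noteq> 0"
    by (metis inv matrix_inv_mult_vector(1) matrix_vector_mult_0_right)
  then have "0 < (matrix_inv A *v x) \<bullet> (A *v (matrix_inv A *v x))"
    using assms by (simp add: pos_def_def)
  then show "0 < x \<bullet> (matrix_inv A *v x)"
    by (simp add: inv matrix_inv_mult_vector inner_commute)
qed

lemma transpose_add: "transpose (A + B) = transpose A + transpose (B :: real^'n^'m)"
  by (simp add: transpose_def vec_eq_iff)

lemma transpose_congruence:
  fixes L :: "real^'n^'m"
  assumes "transpose A = A"
  shows "transpose (L ** A ** transpose L) = L ** A ** transpose L"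
  by (simp add: assms matrix_transpose_mul matrix_mul_assoc)

lemma wnorm2_add_weight: "wnorm2 (A + B) x = wnorm2 A x + wnorm2 B x"
  by (simp add: wnorm2_def matrix_vector_mult_add_rdistrib inner_add_right)

lemma wnorm2_scaleR_weight: "wnorm2 (c *\<^sub>R A) x = c * wnorm2 A x"
  by (simp add: wnorm2_def scaleR_matrix_vector_assoc[symmetric])

lemma wnorm2_congruence:
  fixes L :: "real^'n^'m"
  shows "wnorm2 (L ** A ** transpose L) x = wnorm2 A (transpose L *v x)"
  using inner_transpose_matrix[of "A *v (transpose L *v x)" L x]
  by (simp add: wnorm2_def inner_commute flip: matrix_vector_mul_assoc
      del: transpose_matrix_vector)

text \<open>The congruence term is in general only semidefinite, since \<open>transpose L\<close>
  may have a kernel; strict positivity comes from \<open>B\<close>.\<close>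

lemma pos_def_add_congruence:
  fixes L :: "real^'n^'m"
  assumes "pos_def B" and "pos_def A"
  shows "pos_def (B + L ** A ** transpose L)"
proof -
  have "0 < wnorm2 (B + L ** A ** transpose L) x" if "x \<noteq> 0" for x
    unfolding wnorm2_add_weight wnorm2_congruence
    using assms that by (intro add_pos_nonneg pos_def_wnorm2_pos pos_def_wnorm2_nonneg)
  moreover have "transpose (B + L ** A ** transpose L) = B + L ** A ** transpose L"
    unfolding transpose_add transpose_congruence[OF pos_def_symmetric[OF assms(2)]]
    by (simp add: pos_def_symmetric[OF assms(1)])
  ultimately show ?thesis
    by (simp add: pos_def_def wnorm2_def)
qed

lemma pos_def_scaleR:
  assumes "pos_def A" and "0 < c"
  shows "pos_def (c *\<^sub>R A)"
  using assms by (auto simp: pos_def_def transpose_scalar scaleR_matrix_vector_assoc[symmetric])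

section \<open>Completion of the square\<close>

text \<open>With \<open>w\<close> the residual at \<open>a\<close> weighted by the inverse of
  \<open>S\<close>, and \<open>l\<close> its image under \<open>transpose L\<close>, the two
  differences are \<open>A *v l + d\<close> and \<open>B *v w - L *v d\<close>. The inverse weights
  then cancel against \<open>A\<close> and \<open>B\<close>, and the cross terms in \<open>d\<close>
  cancel each other. The form with mere invertibility also covers the negative definite
  \<open>B\<close> in \<open>terminal_max\<close>.\<close>

lemma wnorm2_complete_square:
  fixes A :: "real^'n^'n" and B :: "real^'m^'m" and L :: "real^'n^'m"
  defines "S \<equiv> B + L ** A ** transpose L"
  defines "M \<equiv> matrix_inv A + transpose L ** matrix_inv B ** L"
  assumes symA: "transpose A = A" and invA: "invertible A"
    and symB: "transpose B = B" and invB: "invertible B"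
    and invS: "invertible S"
  shows "wnorm2 (matrix_inv A) (x - a) + wnorm2 (matrix_inv B) (b - L *v x)
    = wnorm2 (matrix_inv S) (b - L *v a)
      + wnorm2 M (x - (a + A *v (transpose L *v (matrix_inv S *v (b - L *v a)))))"
proof -
  define e where "e = b - L *v a"
  define w where "w = matrix_inv S *v e"
  define l where "l = transpose L *v w"
  define d where "d = x - (a + A *v l)"
  note symA' = transpose_matrix_inv_symmetric[OF symA invA]
  note symB' = transpose_matrix_inv_symmetric[OF symB invB]
  \<comment> \<open>This is \<open>S *v w = e\<close>, split along the two summands of
    \<open>S\<close>.\<close>
  have Sw: "B *v w + L *v (A *v l) = e"
    using matrix_inv_mult_vector(1)[OF invS, of e, folded w_def]
    by (simp add: S_def l_def matrix_vector_mult_add_rdistrib flip: matrix_vector_mul_assoc)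
  have xa: "x - a = A *v l + d"
    by (simp add: d_def)
  have x_eq: "x = a + (A *v l + d)"
    by (simp add: d_def)
  have bx: "b - L *v x = B *v w - L *v d"
    unfolding x_eq matrix_vector_right_distrib using Sw by (simp add: e_def algebra_simps)
  have 1: "wnorm2 (matrix_inv A) (x - a)
      = (A *v l) \<bullet> l + 2 * (d \<bullet> l) + wnorm2 (matrix_inv A) d"
    unfolding xa wnorm2_def matrix_vector_right_distrib matrix_inv_mult_vector(2)[OF invA]
    using inner_symmetric_matrix[OF symA', of "A *v l" d]
    by (simp add: matrix_inv_mult_vector(2)[OF invA] inner_add_left inner_add_right inner_commute)
  have 2: "wnorm2 (matrix_inv B) (B *v w - L *v d)
      = (B *v w) \<bullet> w - 2 * ((L *v d) \<bullet> w) + wnorm2 (matrix_inv B) (L *v d)"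
    unfolding wnorm2_def matrix_vector_mult_diff_distrib matrix_inv_mult_vector(2)[OF invB]
    using inner_symmetric_matrix[OF symB', of "B *v w" "L *v d"]
    by (simp add: matrix_inv_mult_vector(2)[OF invB] inner_diff_left inner_diff_right inner_commute)
  have 3: "d \<bullet> l = (L *v d) \<bullet> w" "(A *v l) \<bullet> l = (L *v (A *v l)) \<bullet> w"
    unfolding l_def by (rule inner_transpose_matrix)+
  have 4: "wnorm2 M d = wnorm2 (matrix_inv A) d + wnorm2 (matrix_inv B) (L *v d)"
    by (simp add: M_def wnorm2_add_weight)
      (simp add: wnorm2_def matrix_vector_mul_assoc[symmetric] inner_transpose_matrix
        del: transpose_matrix_vector)
  have 5: "wnorm2 (matrix_inv S) e = (B *v w) \<bullet> w + (L *v (A *v l)) \<bullet> w"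
    by (simp add: wnorm2_def w_def[symmetric] inner_add_left[symmetric] Sw)
  show ?thesis
    unfolding e_def[symmetric] w_def[symmetric] l_def[symmetric] d_def[symmetric]
    unfolding bx 1 2 4 5 3 by simp
qed

text \<open>The Woodbury identity, checked on a vector \<open>v\<close>: the second factor sends
  \<open>v\<close> to \<open>A *v (v - transpose L *v w)\<close>, and \<open>L\<close> sends that to
  \<open>B *v w\<close>. The two summands of the first factor therefore give
  \<open>v - transpose L *v w\<close> and \<open>transpose L *v w\<close>.\<close>

lemma complete_square_weight_inverse:
  fixes A :: "real^'n^'n" and B :: "real^'m^'m" and L :: "real^'n^'m"
  defines "S \<equiv> B + L ** A ** transpose L"
  assumes invA: "invertible A" and invB: "invertible B" and invS: "invertible S"
  shows "(matrix_inv A + transpose L ** matrix_inv B ** L)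
    ** (A - A ** transpose L ** matrix_inv S ** L ** A) = mat 1"
proof -
  have "(matrix_inv A + transpose L ** matrix_inv B ** L)
    *v ((A - A ** transpose L ** matrix_inv S ** L ** A) *v v) = v" for v
  proof -
    define w where "w = matrix_inv S *v (L *v (A *v v))"
    have Sw: "B *v w + L *v (A *v (transpose L *v w)) = L *v (A *v v)"
      using matrix_inv_mult_vector(1)[OF invS, of "L *v (A *v v)", folded w_def]
      by (simp add: S_def matrix_vector_mult_add_rdistrib flip: matrix_vector_mul_assoc)
    have p: "(A - A ** transpose L ** matrix_inv S ** L ** A) *v v
        = A *v (v - transpose L *v w)"
      by (simp add: w_def matrix_vector_mult_diff_rdistrib matrix_vector_mult_diff_distrib
          matrix_vector_mul_assoc matrix_mul_assoc)
    have q: "L *v (A *v (v - transpose L *v w)) = B *v w"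
      using Sw by (simp add: matrix_vector_mult_diff_distrib algebra_simps)
    show ?thesis
      unfolding p matrix_vector_mult_add_rdistrib matrix_vector_mul_assoc[symmetric] q
      by (simp add: matrix_inv_mult_vector invA invB)
  qed
  then show ?thesis
    by (auto simp only: matrix_eq matrix_vector_mul_assoc matrix_vector_mul_lid)
qed

text \<open>Positivity of \<open>C\<close> is read off from its inverse \<open>M\<close>, a positive
  definite matrix plus a congruence; the formula for \<open>C\<close> itself is a
  difference.\<close>

lemma complete_square_pos_def:
  fixes A :: "real^'n^'n" and B :: "real^'m^'m" and L :: "real^'n^'m"
  defines "S \<equiv> B + L ** A ** transpose L"
  defines "C \<equiv> A - A ** transpose L ** matrix_inv S ** L ** A"
  assumes A: "pos_def A" and B: "pos_def B"
  shows "pos_def C"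
    and "wnorm2 (matrix_inv A) (x - a) + wnorm2 (matrix_inv B) (b - L *v x)
      = wnorm2 (matrix_inv S) (b - L *v a)
        + wnorm2 (matrix_inv C)
            (x - (a + A *v (transpose L *v (matrix_inv S *v (b - L *v a)))))"
proof -
  define M where "M = matrix_inv A + transpose L ** matrix_inv B ** L"
  have S: "pos_def S"
    unfolding S_def by (rule pos_def_add_congruence[OF B A])
  note inv = pos_def_invertible[OF A] pos_def_invertible[OF B] pos_def_invertible[OF S]
  have MC: "M ** C = mat 1"
    unfolding M_def C_def S_def
    by (rule complete_square_weight_inverse[OF inv[unfolded S_def]])
  have "pos_def M"
    unfolding M_def
    using pos_def_add_congruence[OF pos_def_matrix_inv[OF A] pos_def_matrix_inv[OF B],
        of "transpose L"] by simp
  then show "pos_def C"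
    using MC pos_def_matrix_inv by (metis matrix_inv_unique_left(1))
  show "wnorm2 (matrix_inv A) (x - a) + wnorm2 (matrix_inv B) (b - L *v x)
      = wnorm2 (matrix_inv S) (b - L *v a)
        + wnorm2 (matrix_inv C)
            (x - (a + A *v (transpose L *v (matrix_inv S *v (b - L *v a)))))"
    unfolding matrix_inv_unique_left(2)[OF MC] M_def S_def
    by (rule wnorm2_complete_square[OF pos_def_symmetric[OF A] inv(1) pos_def_symmetric[OF B]
          inv(2) inv(3)[unfolded S_def]])
qed

section \<open>One step of the Kalman filter\<close>

text \<open>Completing the square with \<open>R\<close> and then with \<open>Q\<close> leaves the
  old state \<open>x\<close> in a single square, which is nonnegative and vanishes at one point. So
  \<open>val\<close> is the minimum of \<open>J\<close> over \<open>x\<close>.\<close>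

lemma kalman_step:
  fixes F P Q :: "real^'n^'n" and H :: "real^'n^'m" and R :: "real^'m^'m"
  defines "S \<equiv> innov_cov H R P"
  defines "P' \<equiv> Q + F ** (P - P ** transpose H ** matrix_inv S ** H ** P) ** transpose F"
  defines "J \<equiv> \<lambda>a y v x z. wnorm2 (matrix_inv P) (x - a)
    + (wnorm2 (matrix_inv Q) (z - F *v x - v) + wnorm2 (matrix_inv R) (y - H *v x))"
  defines "val \<equiv> \<lambda>a y v z. wnorm2 (matrix_inv P')
      (z - (F *v a + (F ** P ** transpose H ** matrix_inv S) *v (y - H *v a) + v))
    + wnorm2 (matrix_inv S) (H *v a - y)"
  assumes P: "pos_def P" and Q: "pos_def Q" and R: "pos_def R"
  shows "pos_def P'"
    and "val a y v z \<le> J a y v x z"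
    and "\<exists>x. J a y v x z = val a y v z"
proof -
  define C where "C = P - P ** transpose H ** matrix_inv S ** H ** P"
  define c where "c = a + P *v (transpose H *v (matrix_inv S *v (y - H *v a)))"
  \<comment> \<open>\<open>T\<close> and \<open>x0\<close> are the matrix and the centre produced by
    the second completion: for a fixed successor \<open>z\<close>, the state \<open>x0\<close> is
    the best predecessor.\<close>
  define T where "T = C - C ** transpose F ** matrix_inv P' ** F ** C"
  define x0 where "x0 = c + C *v (transpose F *v (matrix_inv P' *v ((z - v) - F *v c)))"
  have P'_eq: "P' = Q + F ** C ** transpose F"
    by (simp add: P'_def C_def)
  have C: "pos_def C"
    unfolding C_def S_def innov_cov_def by (rule complete_square_pos_def(1)[OF P R])
  show "pos_def P'"
    unfolding P'_eq by (rule pos_def_add_congruence[OF Q C])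
  have T: "pos_def T"
    unfolding T_def P'_eq by (rule complete_square_pos_def(1)[OF C Q])
  have meas: "wnorm2 (matrix_inv P) (x - a) + wnorm2 (matrix_inv R) (y - H *v x)
      = wnorm2 (matrix_inv S) (y - H *v a) + wnorm2 (matrix_inv C) (x - c)" for x
    unfolding C_def S_def c_def innov_cov_def by (rule complete_square_pos_def(2)[OF P R])
  have time: "wnorm2 (matrix_inv C) (x - c) + wnorm2 (matrix_inv Q) ((z - v) - F *v x)
      = wnorm2 (matrix_inv P') ((z - v) - F *v c) + wnorm2 (matrix_inv T) (x - x0)" for x
    unfolding T_def x0_def P'_eq by (rule complete_square_pos_def(2)[OF C Q])
  \<comment> \<open>Propagating the corrected estimate \<open>c\<close> by \<open>F\<close>
    reproduces the one-step recursion with the gain.\<close>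
  have Fc: "F *v c = F *v a + (F ** P ** transpose H ** matrix_inv S) *v (y - H *v a)"
    by (simp add: c_def matrix_vector_right_distrib matrix_vector_mul_assoc matrix_mul_assoc)
  have val: "val a y v z
      = wnorm2 (matrix_inv P') ((z - v) - F *v c) + wnorm2 (matrix_inv S) (y - H *v a)"
    by (simp add: val_def Fc wnorm2_minus_commute[of _ "H *v a"] diff_diff_eq add_ac)
  have J: "J a y v x z = val a y v z + wnorm2 (matrix_inv T) (x - x0)" for x
    using meas[of x] time[of x] by (simp add: J_def val algebra_simps)
  show "val a y v z \<le> J a y v x z"
    by (simp add: J pos_def_wnorm2_nonneg[OF pos_def_matrix_inv[OF T]])
  show "\<exists>x. J a y v x z = val a y v z"
    by (rule exI[of _ x0]) (simp add: J)
qed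

section \<open>Forward dynamic programming\<close>

text \<open>The disturbance penalty of one model, without the factor
  \<open>\<gamma>\<^sup>2\<close>.\<close>

definition traj_cost :: "real^'n^'n \<Rightarrow> real^'n^'m \<Rightarrow> real^'p^'n \<Rightarrow> real^'n^'n \<Rightarrow> real^'m^'m
    \<Rightarrow> real^'n^'n \<Rightarrow> real^'n \<Rightarrow> (nat \<Rightarrow> real^'m) \<Rightarrow> (nat \<Rightarrow> real^'p) \<Rightarrow> nat
    \<Rightarrow> (nat \<Rightarrow> real^'n) \<Rightarrow> real" where
  "traj_cost F H G Q R P0 xhat0 y u N x =
     wnorm2 (matrix_inv P0) (x 0 - xhat0)
     + (\<Sum>t<N. wnorm2 (matrix_inv Q) (x (t + 1) - F *v x t - G *v u t)
              + wnorm2 (matrix_inv R) (y t - H *v x t))"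

lemma traj_cost_Suc:
  "traj_cost F H G Q R P0 xhat0 y u (Suc N) x = traj_cost F H G Q R P0 xhat0 y u N x
     + (wnorm2 (matrix_inv Q) (x (Suc N) - F *v x N - G *v u N)
        + wnorm2 (matrix_inv R) (y N - H *v x N))"
  by (simp add: traj_cost_def)

lemma traj_cost_cong:
  assumes "\<And>t. t \<le> N \<Longrightarrow> x t = x' t"
  shows "traj_cost F H G Q R P0 xhat0 y u N x = traj_cost F H G Q R P0 xhat0 y u N x'"
  using assms by (simp add: traj_cost_def)

text \<open>The value function of the forward recursion in closed form: the least
  \<open>traj_cost\<close> among trajectories ending in \<open>z\<close>, as the lemmas below
  establish.\<close>

definition arrival_cost :: "real^'n^'n \<Rightarrow> real^'n^'m \<Rightarrow> real^'p^'n \<Rightarrow> real^'n^'n \<Rightarrow> real^'m^'m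
    \<Rightarrow> real^'n^'n \<Rightarrow> real^'n \<Rightarrow> (nat \<Rightarrow> real^'m) \<Rightarrow> (nat \<Rightarrow> real^'p) \<Rightarrow> nat \<Rightarrow> real^'n
    \<Rightarrow> real" where
  "arrival_cost F H G Q R P0 xhat0 y u N z =
     wnorm2 (matrix_inv (Pmat F H Q R P0 N)) (z - xbreve F H G Q R P0 xhat0 y u N)
     + cacc F H G Q R P0 xhat0 y u N"

lemma pos_def_Pmat:
  assumes "pos_def P0" and "pos_def Q" and "pos_def R"
  shows "pos_def (Pmat F H Q R P0 N)"
proof (induction N)
  case 0
  show ?case
    by (simp add: assms)
next
  case (Suc N)
  show ?case
    unfolding Pmat.simps Let_def by (rule kalman_step(1)[OF Suc.IH assms(2,3)])
qed

text \<open>The Bellman equation, stated as a lower bound together with its attainment. The constant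
  term of \<open>kalman_step\<close> is exactly the increment of \<open>cacc\<close>.\<close>

lemma arrival_cost_step:
  fixes F :: "real^'n^'n" and H :: "real^'n^'m" and G :: "real^'p^'n"
    and y :: "nat \<Rightarrow> real^'m" and u :: "nat \<Rightarrow> real^'p"
  assumes "pos_def P0" and "pos_def Q" and "pos_def R"
  defines "stage \<equiv> \<lambda>N x z. wnorm2 (matrix_inv Q) (z - F *v x - G *v u N)
        + wnorm2 (matrix_inv R) (y N - H *v x)"
  shows "arrival_cost F H G Q R P0 xhat0 y u (Suc N) z
      \<le> arrival_cost F H G Q R P0 xhat0 y u N x + stage N x z"
    and "\<exists>x. arrival_cost F H G Q R P0 xhat0 y u N x + stage N x z
      = arrival_cost F H G Q R P0 xhat0 y u (Suc N) z"
proof -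
  note P = pos_def_Pmat[OF assms(1-3), of F H N]
  let ?P = "Pmat F H Q R P0 N"
  let ?a = "xbreve F H G Q R P0 xhat0 y u N"
  show "arrival_cost F H G Q R P0 xhat0 y u (Suc N) z
      \<le> arrival_cost F H G Q R P0 xhat0 y u N x + stage N x z"
    using kalman_step(2)[OF P assms(2,3), where F = F and H = H and z = z and a = ?a and y = "y N"
        and v = "G *v u N" and x = x]
    unfolding arrival_cost_def stage_def Pmat.simps xbreve.simps cacc.simps gain_def Let_def
    by linarith
  show "\<exists>x. arrival_cost F H G Q R P0 xhat0 y u N x + stage N x z
      = arrival_cost F H G Q R P0 xhat0 y u (Suc N) z"
  proof -
    obtain x where "wnorm2 (matrix_inv ?P) (x - ?a) + stage N x z
        = wnorm2 (matrix_inv (Pmat F H Q R P0 (Suc N)))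
            (z - xbreve F H G Q R P0 xhat0 y u (Suc N))
          + wnorm2 (matrix_inv (innov_cov H R ?P)) (H *v ?a - y N)"
      using kalman_step(3)[OF P assms(2,3), where F = F and H = H and z = z and a = ?a and y = "y N"
          and v = "G *v u N"]
      unfolding stage_def Pmat.simps xbreve.simps gain_def Let_def by blast
    then have "arrival_cost F H G Q R P0 xhat0 y u N x + stage N x z
        = arrival_cost F H G Q R P0 xhat0 y u (Suc N) z"
      unfolding arrival_cost_def cacc.simps by linarith
    then show ?thesis
      by blast
  qed
qed

lemma arrival_cost_le_traj_cost:
  assumes "pos_def P0" and "pos_def Q" and "pos_def R"
  shows "arrival_cost F H G Q R P0 xhat0 y u N (x N) \<le> traj_cost F H G Q R P0 xhat0 y u N x"
proof (induction N)
  case 0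
  show ?case by (simp add: arrival_cost_def traj_cost_def)
next
  case (Suc N)
  then show ?case
    using arrival_cost_step(1)[OF assms, where F = F and H = H and G = G and ?xhat0.0 = xhat0
        and y = y and u = u and N = N and x = "x N" and z = "x (Suc N)"]
    unfolding traj_cost_Suc by linarith
qed

text \<open>An optimal trajectory is found backwards: choose the best predecessor \<open>w\<close>
  of \<open>z\<close>, then an optimal trajectory ending in \<open>w\<close>. This is why the
  induction generalizes over \<open>z\<close>.\<close>

lemma arrival_cost_attained:
  assumes "pos_def P0" and "pos_def Q" and "pos_def R"
  shows "\<exists>x. x N = z \<and> traj_cost F H G Q R P0 xhat0 y u N x
    = arrival_cost F H G Q R P0 xhat0 y u N z"
proof (induction N arbitrary: z)
  case 0
  show ?case
    by (rule exI[of _ "\<lambda>_. z"]) (simp add: arrival_cost_def traj_cost_def)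
next
  case (Suc N)
  obtain w where w: "arrival_cost F H G Q R P0 xhat0 y u N w
      + (wnorm2 (matrix_inv Q) (z - F *v w - G *v u N) + wnorm2 (matrix_inv R) (y N - H *v w))
      = arrival_cost F H G Q R P0 xhat0 y u (Suc N) z"
    using arrival_cost_step(2)[OF assms] by blast
  obtain x where x: "x N = w"
    "traj_cost F H G Q R P0 xhat0 y u N x = arrival_cost F H G Q R P0 xhat0 y u N w"
    using Suc.IH by blast
  \<comment> \<open>Overwriting the state at time \<open>Suc N\<close> leaves the cost up to time
    \<open>N\<close> unchanged.\<close>
  have "traj_cost F H G Q R P0 xhat0 y u N (x(Suc N := z))
      = traj_cost F H G Q R P0 xhat0 y u N x"
    by (rule traj_cost_cong) simp
  then show ?case
    by (intro exI[of _ "x(Suc N := z)"]) (simp add: traj_cost_Suc x w del: fun_upd_apply, simp add: x w)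
qed

section \<open>The supremum over the terminal state\<close>

lemma matrix_mult_scaleR:
  fixes A :: "real^'n^'m" and B :: "real^'k^'n"
  shows "(c *\<^sub>R A) ** B = c *\<^sub>R (A ** B)" and "A ** (c *\<^sub>R B) = c *\<^sub>R (A ** B)"
  by (simp_all only: scalar_matrix_assoc matrix_scalar_ac)

lemma matrix_inv_scaleR:
  fixes A :: "real^'n^'n"
  assumes "invertible A" and "c \<noteq> 0"
  shows "matrix_inv (c *\<^sub>R A) = (1 / c) *\<^sub>R matrix_inv A" and "invertible (c *\<^sub>R A)"
proof -
  have "(c *\<^sub>R A) ** ((1 / c) *\<^sub>R matrix_inv A) = mat 1"
    using assms by (simp add: matrix_mult_scaleR matrix_inv_inverse)
  then show "matrix_inv (c *\<^sub>R A) = (1 / c) *\<^sub>R matrix_inv A" and "invertible (c *\<^sub>R A)"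
    by (rule matrix_inv_unique_left)+
qed

lemma wnorm2_mat_1: "wnorm2 (mat 1) x = (norm x)\<^sup>2"
  by (simp add: wnorm2_def dot_square_norm)

lemma pos_def_attenuation:
  fixes H :: "real^'n^'m"
  assumes "H ** P ** transpose H \<prec>\<^sub>L \<gamma>\<^sup>2 *\<^sub>R mat 1" and "0 < \<gamma>"
  shows "pos_def (mat 1 - (1 / \<gamma>\<^sup>2) *\<^sub>R (H ** P ** transpose H))"
proof -
  have "pos_def ((1 / \<gamma>\<^sup>2) *\<^sub>R (\<gamma>\<^sup>2 *\<^sub>R mat 1 - H ** P ** transpose H))"
    using assms by (intro pos_def_scaleR) (simp_all add: loewner_less_def)
  then show ?thesis
    using assms(2) by (simp add: scaleR_diff_right)
qed

text \<open>Completing the square with \<open>B\<close> equal to \<open>- \<gamma>\<^sup>2\<close>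
  times the identity gives \<open>S\<close> as \<open>- \<gamma>\<^sup>2\<close> times
  \<open>W\<close>. Multiplying by \<open>- \<gamma>\<^sup>2\<close> turns the remaining square into
  a nonpositive term, so its centre \<open>x0\<close> is a maximizer.\<close>

lemma terminal_max:
  fixes P :: "real^'n^'n" and H :: "real^'n^'m" and \<gamma> :: real
  defines "W \<equiv> mat 1 - (1 / \<gamma>\<^sup>2) *\<^sub>R (H ** P ** transpose H)"
  assumes P: "pos_def P" and less: "H ** P ** transpose H \<prec>\<^sub>L \<gamma>\<^sup>2 *\<^sub>R mat 1" and \<gamma>: "0 < \<gamma>"
  shows "(norm (b - H *v x))\<^sup>2 - \<gamma>\<^sup>2 * wnorm2 (matrix_inv P) (x - a)
      \<le> wnorm2 (matrix_inv W) (b - H *v a)"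
    and "\<exists>x. (norm (b - H *v x))\<^sup>2 - \<gamma>\<^sup>2 * wnorm2 (matrix_inv P) (x - a)
      = wnorm2 (matrix_inv W) (b - H *v a)"
proof -
  define B :: "real^'m^'m" where "B = (- \<gamma>\<^sup>2) *\<^sub>R mat 1"
  define S where "S = B + H ** P ** transpose H"
  define M where "M = matrix_inv P + transpose H ** matrix_inv B ** H"
  define C where "C = P - P ** transpose H ** matrix_inv S ** H ** P"
  define x0 where "x0 = a + P *v (transpose H *v (matrix_inv S *v (b - H *v a)))"
  have W: "pos_def W"
    unfolding W_def by (rule pos_def_attenuation[OF less \<gamma>])
  have S_eq: "S = (- \<gamma>\<^sup>2) *\<^sub>R W"
    using \<gamma> by (simp add: S_def B_def W_def scaleR_diff_right)
  have invS: "invertible S" and S': "matrix_inv S = (- 1 / \<gamma>\<^sup>2) *\<^sub>R matrix_inv W"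
    using matrix_inv_scaleR[OF pos_def_invertible[OF W], of "- \<gamma>\<^sup>2"] \<gamma> by (simp_all add: S_eq)
  have inv1: "invertible (mat 1 :: real^'m^'m)" "matrix_inv (mat 1 :: real^'m^'m) = mat 1"
    using matrix_inv_unique_left[of "mat 1 :: real^'m^'m" "mat 1"] by simp_all
  have invB: "invertible B" and B': "matrix_inv B = (- 1 / \<gamma>\<^sup>2) *\<^sub>R mat 1"
    using matrix_inv_scaleR[OF inv1(1), of "- \<gamma>\<^sup>2"] \<gamma> by (simp_all add: B_def inv1(2))
  have symB: "transpose B = B"
    by (simp only: B_def transpose_scalar transpose_mat)
  note invP = pos_def_invertible[OF P]
  have MC: "M ** C = mat 1"
    unfolding M_def C_def S_def
    by (rule complete_square_weight_inverse[OF invP invB invS[unfolded S_def]])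
  have symP: "transpose P = P"
    by (rule pos_def_symmetric[OF P])
  \<comment> \<open>The negative sign of \<open>S\<close> turns the subtraction in \<open>C\<close>
    into the addition of a congruence. Hence \<open>C\<close>, and with it \<open>M\<close>, is
    positive definite; this is where the bound by \<open>\<gamma>\<^sup>2\<close> enters.\<close>
  have "C = P + (P ** transpose H) ** ((1 / \<gamma>\<^sup>2) *\<^sub>R matrix_inv W) ** transpose (P ** transpose H)"
    unfolding C_def S' matrix_mult_scaleR by (simp add: matrix_transpose_mul symP matrix_mul_assoc)
  moreover have "pos_def ((1 / \<gamma>\<^sup>2) *\<^sub>R matrix_inv W)"
    using \<gamma> by (intro pos_def_scaleR pos_def_matrix_inv W) simp
  ultimately have "pos_def C"
    using pos_def_add_congruence[OF P] by metis
  then have M: "pos_def M"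
    using MC pos_def_matrix_inv by (metis matrix_inv_unique_left(2))
  have "wnorm2 (matrix_inv P) (x - a) + wnorm2 (matrix_inv B) (b - H *v x)
      = wnorm2 (matrix_inv S) (b - H *v a) + wnorm2 M (x - x0)" for x
    unfolding M_def S_def x0_def
    by (rule wnorm2_complete_square[OF symP invP symB invB invS[unfolded S_def]])
  then have sq: "wnorm2 (matrix_inv P) (x - a)
      = (norm (b - H *v x))\<^sup>2 / \<gamma>\<^sup>2 - wnorm2 (matrix_inv W) (b - H *v a) / \<gamma>\<^sup>2 + wnorm2 M (x - x0)"
    for x
    unfolding B' S' wnorm2_scaleR_weight wnorm2_mat_1 by (simp add: algebra_simps)
  have eq: "(norm (b - H *v x))\<^sup>2 - \<gamma>\<^sup>2 * wnorm2 (matrix_inv P) (x - a)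
      = wnorm2 (matrix_inv W) (b - H *v a) - \<gamma>\<^sup>2 * wnorm2 M (x - x0)" for x
    unfolding sq using \<gamma> by (simp add: field_simps)
  show "(norm (b - H *v x))\<^sup>2 - \<gamma>\<^sup>2 * wnorm2 (matrix_inv P) (x - a)
      \<le> wnorm2 (matrix_inv W) (b - H *v a)"
    by (simp add: eq pos_def_wnorm2_nonneg[OF M])
  show "\<exists>x. (norm (b - H *v x))\<^sup>2 - \<gamma>\<^sup>2 * wnorm2 (matrix_inv P) (x - a)
      = wnorm2 (matrix_inv W) (b - H *v a)"
    by (rule exI[of _ x0]) (simp add: eq)
qed

section \<open>The cost as a finite maximum\<close>

text \<open>The left-hand side of one constraint of the program. The next proof identifies it as the
  worst case over all trajectories of that model.\<close>

definition model_cost :: "real^'n^'n \<Rightarrow> real^'n^'m \<Rightarrow> real^'p^'n \<Rightarrow> real^'n^'n \<Rightarrow> real^'m^'m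
    \<Rightarrow> real^'n^'n \<Rightarrow> real^'n \<Rightarrow> real \<Rightarrow> nat \<Rightarrow> (nat \<Rightarrow> real^'m) \<Rightarrow> (nat \<Rightarrow> real^'p) \<Rightarrow> real^'m
    \<Rightarrow> real" where
  "model_cost F H G Q R P0 xhat0 \<gamma> N y u yhat =
     wnorm2 (matrix_inv (mat 1 - (1 / \<gamma>\<^sup>2) *\<^sub>R (H ** Pmat F H Q R P0 N ** transpose H)))
       (yhat - H *v xbreve F H G Q R P0 xhat0 y u N)
     - \<gamma>\<^sup>2 * cacc F H G Q R P0 xhat0 y u N"

lemma feasible_iff:
  "feasible K F H G Q R P0 xhat0 \<gamma> N y u (yhat, s) \<longleftrightarrow>
     (\<forall>i\<in>{1..K}. model_cost (F i) (H i) (G i) Q R P0 xhat0 \<gamma> N y u yhat \<le> s)"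
  by (simp add: feasible_def model_cost_def)

text \<open>For each model, the penalty is first minimized with the terminal state fixed and the
  terminal state is then eliminated by \<open>terminal_max\<close>. Both optima are attained, so the
  extended-real supremum is a maximum and hence finite.\<close>

lemma cost_eq_Max:
  fixes F :: "nat \<Rightarrow> real^'n^'n" and H :: "nat \<Rightarrow> real^'n^'m" and G :: "nat \<Rightarrow> real^'p^'n"
  assumes "K \<ge> 1" and pd: "pos_def P0" "pos_def Q" "pos_def R" and \<gamma>: "\<gamma> > 0"
    and less: "\<And>i. i \<in> {1..K} \<Longrightarrow>
           H i ** Pmat (F i) (H i) Q R P0 N ** transpose (H i) \<prec>\<^sub>L \<gamma>\<^sup>2 *\<^sub>R mat 1"
  shows "cost K F H G Q R P0 xhat0 \<gamma> N y u yhat =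
    ereal (Max ((\<lambda>i. model_cost (F i) (H i) (G i) Q R P0 xhat0 \<gamma> N y u yhat) ` {1..K}))"
    (is "_ = ereal (Max (?phi ` _))")
proof -
  define J where "J = (\<lambda>x i. (norm (yhat - H i *v x N))\<^sup>2
    - \<gamma>\<^sup>2 * traj_cost (F i) (H i) (G i) Q R P0 xhat0 y u N x)"
  have cost: "cost K F H G Q R P0 xhat0 \<gamma> N y u yhat
      = (SUP (x, i) \<in> ({0..N} \<rightarrow>\<^sub>E UNIV) \<times> {1..K}. ereal (J x i))"
    by (simp add: cost_def J_def traj_cost_def algebra_simps)
  have bound: "J x i \<le> ?phi i" if i: "i \<in> {1..K}" for x i
  proof -
    have "\<gamma>\<^sup>2 * arrival_cost (F i) (H i) (G i) Q R P0 xhat0 y u N (x N)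
        \<le> \<gamma>\<^sup>2 * traj_cost (F i) (H i) (G i) Q R P0 xhat0 y u N x"
      by (intro mult_left_mono arrival_cost_le_traj_cost pd) simp
    then show ?thesis
      using terminal_max(1)[OF pos_def_Pmat[OF pd] less[OF i] \<gamma>, of yhat "x N"
          "xbreve (F i) (H i) (G i) Q R P0 xhat0 y u N"]
      by (simp add: J_def model_cost_def arrival_cost_def algebra_simps)
  qed
  have attained: "\<exists>x \<in> {0..N} \<rightarrow>\<^sub>E UNIV. J x i = ?phi i" if i: "i \<in> {1..K}" for i
  proof -
    obtain z where z: "(norm (yhat - H i *v z))\<^sup>2
        - \<gamma>\<^sup>2 * wnorm2 (matrix_inv (Pmat (F i) (H i) Q R P0 N))
            (z - xbreve (F i) (H i) (G i) Q R P0 xhat0 y u N)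
        = wnorm2 (matrix_inv (mat 1 - (1 / \<gamma>\<^sup>2) *\<^sub>R
            (H i ** Pmat (F i) (H i) Q R P0 N ** transpose (H i))))
          (yhat - H i *v xbreve (F i) (H i) (G i) Q R P0 xhat0 y u N)"
      using terminal_max(2)[OF pos_def_Pmat[OF pd] less[OF i] \<gamma>] by blast
    obtain x where x: "x N = z" "traj_cost (F i) (H i) (G i) Q R P0 xhat0 y u N x
        = arrival_cost (F i) (H i) (G i) Q R P0 xhat0 y u N z"
      using arrival_cost_attained[OF pd] by blast
    \<comment> \<open>The supremum ranges over extensional functions; restriction yields one at the
      same cost.\<close>
    have "traj_cost (F i) (H i) (G i) Q R P0 xhat0 y u N (restrict x {0..N})
        = traj_cost (F i) (H i) (G i) Q R P0 xhat0 y u N x"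
      by (rule traj_cost_cong) simp
    then have "J (restrict x {0..N}) i = ?phi i"
      using z by (simp add: J_def x model_cost_def arrival_cost_def algebra_simps)
    then show ?thesis
      by (intro bexI[of _ "restrict x {0..N}"]) auto
  qed
  show ?thesis
    unfolding cost
  proof (rule antisym)
    show "(SUP (x, i) \<in> ({0..N} \<rightarrow>\<^sub>E UNIV) \<times> {1..K}. ereal (J x i)) \<le> ereal (Max (?phi ` {1..K}))"
    proof (rule SUP_least, clarify)
      fix x i assume i: "i \<in> {1..K}"
      then have "?phi i \<le> Max (?phi ` {1..K})"
        by (intro Max_ge) auto
      then show "ereal (J x i) \<le> ereal (Max (?phi ` {1..K}))"
        using bound[OF i, of x] by simp
    qed
    have "Max (?phi ` {1..K}) \<in> ?phi ` {1..K}"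
      using \<open>K \<ge> 1\<close> by (intro Max_in) auto
    then obtain i where i: "i \<in> {1..K}" "Max (?phi ` {1..K}) = ?phi i"
      by auto
    obtain x where "x \<in> {0..N} \<rightarrow>\<^sub>E UNIV" "J x i = ?phi i"
      using attained[OF i(1)] by auto
    then show "ereal (Max (?phi ` {1..K}))
        \<le> (SUP (x, i) \<in> ({0..N} \<rightarrow>\<^sub>E UNIV) \<times> {1..K}. ereal (J x i))"
      using i by (intro SUP_upper2[of "(x, i)"]) auto
  qed
qed

section \<open>Existence and uniqueness of the minimizer\<close>

text \<open>By the parallelogram law, the value at the midpoint is the mean of the two values minus
  a quarter of \<open>wnorm2 A (p - q)\<close>. This weak form of strict convexity passes to finite
  maxima and suffices for uniqueness.\<close>

lemma wnorm2_midpoint_less: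
  assumes A: "pos_def A" and "p \<noteq> q"
  shows "wnorm2 A (midpoint p q - c) < max (wnorm2 A (p - c)) (wnorm2 A (q - c))"
proof -
  define v w where "v = p - c" and "w = q - c"
  have mid: "midpoint p q - c = (1 / 2) *\<^sub>R (v + w)"
    by (simp add: v_def w_def midpoint_def algebra_simps flip: scaleR_2)
  have "wnorm2 A (v + w) + wnorm2 A (v - w) = 2 * wnorm2 A v + 2 * wnorm2 A w"
    by (simp add: wnorm2_def matrix_vector_right_distrib matrix_vector_mult_diff_distrib
        inner_add_left inner_add_right inner_diff_left inner_diff_right)
  moreover have "0 < wnorm2 A (v - w)"
    using assms by (intro pos_def_wnorm2_pos) (auto simp: v_def w_def)
  moreover have "wnorm2 A ((1 / 2) *\<^sub>R (v + w)) = wnorm2 A (v + w) / 4"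
    by (simp add: wnorm2_def matrix_vector_mult_scaleR)
  ultimately show ?thesis
    unfolding mid v_def[symmetric] w_def[symmetric] by (simp add: max_def)
qed

lemma continuous_on_Max_image:
  fixes f :: "'i \<Rightarrow> 'a::topological_space \<Rightarrow> real"
  assumes "finite I" and "I \<noteq> {}" and "\<And>i. i \<in> I \<Longrightarrow> continuous_on S (f i)"
  shows "continuous_on S (\<lambda>x. Max ((\<lambda>i. f i x) ` I))"
  using assms
proof (induction I rule: finite_ne_induct)
  case (insert i I)
  then have "continuous_on S (\<lambda>x. max (f i x) (Max ((\<lambda>i. f i x) ` I)))"
    by (intro continuous_on_max) auto
  then show ?case
    using insert by simp
qed simp

text \<open>Coercivity makes the sublevel set through \<open>c\<close> compact, which gives a
  minimizer; the midpoint of two distinct minimizers would have a smaller value.\<close>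

lemma ex1_minimizer:
  fixes g :: "'a::euclidean_space \<Rightarrow> real"
  assumes cont: "continuous_on UNIV g"
    and coercive: "\<And>x. (norm (x - c))\<^sup>2 - k \<le> g x"
    and strict: "\<And>p q. p \<noteq> q \<Longrightarrow> g (midpoint p q) < max (g p) (g q)"
  shows "\<exists>!x. \<forall>z. g x \<le> g z"
proof -
  define S where "S = {x. g x \<le> g c}"
  have "closed S"
    unfolding S_def using cont by (intro closed_Collect_le continuous_intros) auto
  moreover have "S \<subseteq> cball c (sqrt (g c + k))"
  proof
    fix x assume "x \<in> S"
    then have "(norm (x - c))\<^sup>2 \<le> g c + k"
      using coercive[of x] by (simp add: S_def)
    then have "norm (x - c) \<le> sqrt (g c + k)"
      by (rule real_le_rsqrt)
    then show "x \<in> cball c (sqrt (g c + k))"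
      by (simp add: dist_norm norm_minus_commute)
  qed
  ultimately have "compact S"
    by (meson bounded_cball bounded_subset compact_eq_bounded_closed)
  moreover have "c \<in> S"
    by (simp add: S_def)
  ultimately obtain m where m: "m \<in> S" "\<forall>z\<in>S. g m \<le> g z"
    using continuous_attains_inf[of S g] continuous_on_subset[OF cont] by blast
  \<comment> \<open>Outside \<open>S\<close> the values exceed \<open>g c\<close>, which is at least
    \<open>g m\<close>.\<close>
  have "g m \<le> g z" for z
    using m by (cases "z \<in> S") (auto simp: S_def)
  moreover have "p = q" if "\<forall>z. g p \<le> g z" "\<forall>z. g q \<le> g z" for p q
  proof (rule ccontr)
    assume "p \<noteq> q"
    then have "g (midpoint p q) < max (g p) (g q)"
      by (rule strict)
    then show False
      using that by (auto simp: max_def not_le[symmetric] split: if_splits)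
  qed
  ultimately show ?thesis
    by blast
qed

text \<open>Evaluating the bound of \<open>terminal_max\<close> at the filter estimate makes the
  penalty vanish. The resulting Euclidean lower bound supplies coercivity.\<close>

lemma model_cost_ge:
  assumes "pos_def P0" "pos_def Q" "pos_def R" and "0 < \<gamma>"
    and "H ** Pmat F H Q R P0 N ** transpose H \<prec>\<^sub>L \<gamma>\<^sup>2 *\<^sub>R mat 1"
  shows "(norm (yhat - H *v xbreve F H G Q R P0 xhat0 y u N))\<^sup>2
      - \<gamma>\<^sup>2 * cacc F H G Q R P0 xhat0 y u N
    \<le> model_cost F H G Q R P0 xhat0 \<gamma> N y u yhat"
  using terminal_max(1)[OF pos_def_Pmat[OF assms(1-3)] assms(5,4), of yhat
      "xbreve F H G Q R P0 xhat0 y u N" "xbreve F H G Q R P0 xhat0 y u N"]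
  by (simp add: model_cost_def)

lemma model_cost_midpoint_less:
  assumes "0 < \<gamma>" and "H ** Pmat F H Q R P0 N ** transpose H \<prec>\<^sub>L \<gamma>\<^sup>2 *\<^sub>R mat 1"
    and "p \<noteq> q"
  shows "model_cost F H G Q R P0 xhat0 \<gamma> N y u (midpoint p q)
    < max (model_cost F H G Q R P0 xhat0 \<gamma> N y u p) (model_cost F H G Q R P0 xhat0 \<gamma> N y u q)"
  using wnorm2_midpoint_less[OF pos_def_matrix_inv[OF pos_def_attenuation[OF assms(2,1)]] assms(3),
      of "H *v xbreve F H G Q R P0 xhat0 y u N"]
  by (simp add: model_cost_def flip: max_diff_distrib_left)

lemma continuous_on_model_cost:
  "continuous_on UNIV (model_cost F H G Q R P0 xhat0 \<gamma> N y u)"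
  unfolding model_cost_def wnorm2_def
  by (intro continuous_intros linear_continuous_on_compose[OF _ matrix_vector_mul_linear])

theorem corollary2:
  fixes F :: "nat \<Rightarrow> real^'n^'n" and H :: "nat \<Rightarrow> real^'n^'m" and G :: "nat \<Rightarrow> real^'p^'n"
    and Q P0 :: "real^'n^'n" and R :: "real^'m^'m"
    and xhat0 :: "real^'n" and \<gamma> :: real and K N :: nat
    and y :: "nat \<Rightarrow> real^'m" and u :: "nat \<Rightarrow> real^'p"
  assumes "K \<ge> 1" and "N \<ge> 1"
    and "pos_def Q" and "pos_def P0" and "pos_def R" and "\<gamma> > 0"
    and "\<And>i. i \<in> {1..K} \<Longrightarrow>
           H i ** Pmat (F i) (H i) Q R P0 N ** transpose (H i) \<prec>\<^sub>L \<gamma>\<^sup>2 *\<^sub>R mat 1"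
  shows "(\<exists>!z. program_minimizer K F H G Q R P0 xhat0 \<gamma> N y u z) \<and>
         (\<forall>yhat s. program_minimizer K F H G Q R P0 xhat0 \<gamma> N y u (yhat, s) \<longrightarrow>
            (INF y'. cost K F H G Q R P0 xhat0 \<gamma> N y u y') = cost K F H G Q R P0 xhat0 \<gamma> N y u yhat)"
proof -
  define phi where "phi = (\<lambda>i. model_cost (F i) (H i) (G i) Q R P0 xhat0 \<gamma> N y u)"
  define g where "g = (\<lambda>yhat. Max ((\<lambda>i. phi i yhat) ` {1..K}))"
  have cost: "cost K F H G Q R P0 xhat0 \<gamma> N y u yhat = ereal (g yhat)" for yhat
    unfolding g_def phi_def using assms by (intro cost_eq_Max) auto
  have phi_le: "phi i yhat \<le> g yhat" if "i \<in> {1..K}" for i yhat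
    unfolding g_def using that by (intro Max_ge) auto
  have feasible: "feasible K F H G Q R P0 xhat0 \<gamma> N y u (yhat, s) \<longleftrightarrow> g yhat \<le> s" for yhat s
    unfolding feasible_iff g_def phi_def using \<open>K \<ge> 1\<close> by (subst Max_le_iff) auto
  \<comment> \<open>The program is the epigraph form of minimizing \<open>g\<close>; at an optimum
    \<open>s\<close> is tight.\<close>
  have minimizer: "program_minimizer K F H G Q R P0 xhat0 \<gamma> N y u (yhat, s)
      \<longleftrightarrow> s = g yhat \<and> (\<forall>z. g yhat \<le> g z)" for yhat s
    unfolding program_minimizer_def is_arg_min_def
    by (auto simp: feasible not_less) (metis order.refl order.trans order.antisym)+
  have "\<exists>!x. \<forall>z. g x \<le> g z"
  proof (rule ex1_minimizer)
    show "continuous_on UNIV g"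
      unfolding g_def phi_def using \<open>K \<ge> 1\<close>
      by (intro continuous_on_Max_image continuous_on_model_cost) auto
    \<comment> \<open>A single coercive model below the maximum makes the maximum coercive.\<close>
    have one: "1 \<in> {1..K}"
      using \<open>K \<ge> 1\<close> by simp
    show "(norm (x - H 1 *v xbreve (F 1) (H 1) (G 1) Q R P0 xhat0 y u N))\<^sup>2
        - \<gamma>\<^sup>2 * cacc (F 1) (H 1) (G 1) Q R P0 xhat0 y u N \<le> g x" for x
      using model_cost_ge[OF assms(4,3,5,6) assms(7)[OF one]] phi_le[OF one]
      unfolding phi_def by (rule order_trans)
    show "g (midpoint p q) < max (g p) (g q)" if "p \<noteq> q" for p q
    proof -
      have "phi i (midpoint p q) < max (g p) (g q)" if i: "i \<in> {1..K}" for i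
        using model_cost_midpoint_less[OF assms(6) assms(7)[OF i] \<open>p \<noteq> q\<close>] phi_le[OF i]
        unfolding phi_def by (smt (verit) max_def)
      then show ?thesis
        unfolding g_def using \<open>K \<ge> 1\<close> by (subst Max_less_iff) auto
    qed
  qed
  then obtain m where m: "\<forall>z. g m \<le> g z" and unique: "\<And>x. \<forall>z. g x \<le> g z \<Longrightarrow> x = m"
    by blast
  have "\<exists>!z. program_minimizer K F H G Q R P0 xhat0 \<gamma> N y u z"
  proof (rule ex1I[of _ "(m, g m)"])
    show "program_minimizer K F H G Q R P0 xhat0 \<gamma> N y u (m, g m)"
      using m by (simp add: minimizer)
    show "z = (m, g m)" if "program_minimizer K F H G Q R P0 xhat0 \<gamma> N y u z" for z
      using that unique by (cases z) (auto simp: minimizer)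
  qed
  \<comment> \<open>Since the cost equals \<open>g\<close>, the infimum is attained at any global
    minimizer of \<open>g\<close>.\<close>
  moreover have "(INF y'. cost K F H G Q R P0 xhat0 \<gamma> N y u y')
      = cost K F H G Q R P0 xhat0 \<gamma> N y u yhat"
    if "program_minimizer K F H G Q R P0 xhat0 \<gamma> N y u (yhat, s)" for yhat s
    unfolding cost using that minimizer
    by (intro antisym INF_lower INF_greatest) auto
  ultimately show ?thesis
    by blast
qed

end
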